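(* Let $i\in\{1,2\}$. For all $u,v\in X_i$, $$\frac12\int_{\mathbb{R}^{2N}\setminus(C\Omega)^2}a^i_{(x,y)}\left(\frac{|u(x)-u(y)|}{|x-y|^{s_i(x,y)}}\right)\frac{u(x)-u(y)}{|x-y|^{s_i(x,y)}}\,\frac{v(x)-v(y)}{|x-y|^{s_i(x,y)}}\,\frac{dx\,dy}{|x-y|^N}=\int_\Omega v\,(-\Delta)^{s_i(x,\cdot)}_{a^i_{(x,\cdot)}}u\,dx+\int_{C\Omega}v\,\mathcal{N}^{s_i(x,\cdot)}_{a^i(x,\cdot)}u\,dx .$$
   Context: Setting. $N\ge1$, $\Omega\subset\mathbb{R}^N$ is open and bounded with Lipschitz boundary, $C\Omega:=\mathbb{R}^N\setminus\Omega$, $\beta\in L^\infty(C\Omega)$ with $\beta\ge0$. For $i=1,2$: - $s_i:\mathbb{R}^N\times\mathbb{R}^N\to(0,1)$ is continuous, symmetric, with $0<s_i^-:=\inf s_i\le s_i^+:=\sup s_i<1$. - $a^i:\mathbb{R}^N\times\mathbb{R}^N\times\mathbb{R}\to\mathbb{R}$, $a^i_{(x,y)}(t):=a^i(x,y,t)$, satisfies $a^i(x,y,t)=a^i(y,x,t)$, and $\varphi^i_{x,y}(t):=a^i(x,y,|t|)t$ for $t\ne0$, $\varphi^i_{x,y}(0):=0$, is an increasing homeomorphism of $\mathbb{R}$ onto itself. Put $\Phi^i_{x,y}(t):=\int_0^t\varphi^i_{x,y}(\tau)\,d\tau$ for $t\ge0$ and $\widehat\Phi^i_x:=\Phi^i_{x,x}$.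 These are Musielak functions (in particular measurable in the space variables). - There are constants $\varphi_i^\pm$ with $1<\varphi_i^-\le \dfrac{t\varphi^i_{x,y}(t)}{\Phi^i_{x,y}(t)}\le\varphi_i^+<\infty$ for all $(x,y)$ and all $t>0$; and $t\mapsto\Phi^i_{x,y}(\sqrt t)$ is convex on $[0,\infty)$. Function space. For measurable $u:\mathbb{R}^N\to\mathbb{R}$ let $\|u\|_{X_i}:=[u]_{s_i(x,y),\Phi^i_{x,y}}+\|u\|_{\widehat\Phi^i_x}+\|u\|_{\widehat\Phi^i_x,\beta,C\Omega}$, where $[u]_{s_i(x,y),\Phi^i_{x,y}}=\inf\{\lambda>0:\int_{\mathbb{R}^{2N}\setminus(C\Omega)^2}\Phi^i_{x,y}\big(\tfrac{|u(x)-u(y)|}{\lambda|x-y|^{s_i(x,y)}}\big)\tfrac{dx\,dy}{|x-y|^N}\le1\}$, $\|u\|_{\widehat\Phi^i_x}=\inf\{\lambda>0:\int_\Omega\widehat\Phi^i_x(|u(x)|/\lambda)\,dx\le1\}$, $\|u\|_{\widehat\Phi^i_x,\beta,C\Omega}=\inf\{\lambda>0:\int_{C\Omega}\beta(x)\widehat\Phi^i_x(|u(x)|/\lambda)\,dx\le1\}$. $X_i$ is the space of measurable $u:\mathbb{R}^N\to\mathbb{R}$ with $\|u\|_{X_i}<\infty$ (a.e. equal functions identified). Operators. With $k^i_u(x,y):=a^i_{(x,y)}\Big(\tfrac{|u(x)-u(y)|}{|x-y|^{s_i(x,y)}}\Big)\tfrac{u(x)-u(y)}{|x-y|^{s_i(x,y)}}\tfrac{1}{|x-y|^{N+s_i(x,y)}}$,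 $$(-\Delta)^{s_i(x,\cdot)}_{a^i_{(x,\cdot)}}u(x):=\lim_{\varepsilon\searrow0}\int_{\mathbb{R}^N\setminus B_\varepsilon(x)}k^i_u(x,y)\,dy,\qquad \mathcal{N}^{s_i(x,\cdot)}_{a^i(x,\cdot)}u(x):=\int_\Omega k^i_u(x,y)\,dy\quad(x\in\mathbb{R}^N\setminus\Omega).$$
   Formalization: The identity fails for some u,v in X_i; it is proved assuming v(x)k_u(x,y) is absolutely integrable on {x in Ω, |x-y|≥ε} for all ε>0 and on CΩ×Ω, and the principal value converges a.e. in Ω where v≠0 and in L^1(Ω,|v|dx). The left integral converges for all u,v. *)

theory Defs
  imports "HOL-Analysis.Analysis"
begin

text \<open>
  The ambient space R^N is an arbitrary Euclidean space \<open>'a\<close>, with N = \<open>DIM('a)\<close> (so N \<ge> 1).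
  "Measurable" always means Lebesgue measurable.
\<close>

text \<open>
  Near each boundary point, \<open>\<Omega>\<close> is the strict epigraph, in some direction \<open>e\<close>, of a Lipschitz
  function on the hyperplane orthogonal to \<open>e\<close>.
\<close>

definition lipschitz_boundary :: "'a::euclidean_space set \<Rightarrow> bool" where
  "lipschitz_boundary \<Omega> \<longleftrightarrow>
     (\<forall>p\<in>frontier \<Omega>. \<exists>r e L. \<exists>g :: 'a \<Rightarrow> real.
        0 < r \<and> norm e = 1 \<and> L-lipschitz_on {z. z \<bullet> e = 0} g \<and>
        \<Omega> \<inter> ball p r = {x \<in> ball p r. g (x - (x \<bullet> e) *\<^sub>R e) < x \<bullet> e})"

definition variable_order :: "('a::euclidean_space \<Rightarrow> 'a \<Rightarrow> real) \<Rightarrow> bool" where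
  "variable_order s \<longleftrightarrow>
     continuous_on UNIV (\<lambda>(x, y). s x y) \<and>
     (\<forall>x y. s x y = s y x) \<and>
     (\<forall>x y. 0 < s x y \<and> s x y < 1) \<and>
     0 < (INF (x, y)\<in>UNIV. s x y) \<and> (SUP (x, y)\<in>UNIV. s x y) < 1"

definition musielak_phi ::
    "('a \<Rightarrow> 'a \<Rightarrow> real \<Rightarrow> real) \<Rightarrow> 'a \<Rightarrow> 'a \<Rightarrow> real \<Rightarrow> real" where
  "musielak_phi a x y t = (if t = 0 then 0 else a x y \<bar>t\<bar> * t)"

text \<open>Only used for \<open>t \<ge> 0\<close>.\<close>

definition musielak_Phi ::
    "('a \<Rightarrow> 'a \<Rightarrow> real \<Rightarrow> real) \<Rightarrow> 'a \<Rightarrow> 'a \<Rightarrow> real \<Rightarrow> real" where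
  "musielak_Phi a x y t = integral {0..t} (musielak_phi a x y)"

definition musielak_Phi_hat ::
    "('a \<Rightarrow> 'a \<Rightarrow> real \<Rightarrow> real) \<Rightarrow> 'a \<Rightarrow> real \<Rightarrow> real" where
  "musielak_Phi_hat a x = musielak_Phi a x x"

text \<open>
  The requirement that \<open>\<Phi>\<close> and its diagonal restriction be Musielak functions enters through
  measurability in the space variables; the other defining properties (continuity, convexity,
  \<open>\<Phi>(t)/t \<rightarrow> 0\<close> at 0 and \<open>\<rightarrow> \<infinity>\<close> at infinity) follow from \<open>\<phi>\<close> being an increasing
  homeomorphism. Measurability on the diagonal is separate, since the diagonal is a null set.
\<close>

definition musielak_structure ::
    "('a::euclidean_space \<Rightarrow> 'a \<Rightarrow> real \<Rightarrow> real) \<Rightarrow> real \<Rightarrow> real \<Rightarrow> bool" where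
  "musielak_structure a \<phi>m \<phi>p \<longleftrightarrow>
     (\<forall>x y t. a x y t = a y x t) \<and>
     (\<forall>x y. strict_mono (musielak_phi a x y) \<and>
            (\<exists>h. homeomorphism UNIV UNIV (musielak_phi a x y) h)) \<and>
     (\<forall>t\<ge>0. (\<lambda>(x, y). musielak_Phi a x y t) \<in> borel_measurable lebesgue) \<and>
     (\<forall>t\<ge>0. (\<lambda>x. musielak_Phi_hat a x t) \<in> borel_measurable lebesgue) \<and>
     1 < \<phi>m \<and>
     (\<forall>x y. \<forall>t>0. \<phi>m \<le> t * musielak_phi a x y t / musielak_Phi a x y t \<and>
                    t * musielak_phi a x y t / musielak_Phi a x y t \<le> \<phi>p) \<and>
     (\<forall>x y. convex_on {0..} (\<lambda>t. musielak_Phi a x y (sqrt t)))"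

text \<open>R^{2N} minus the square of the complement of \<open>\<Omega>\<close>.\<close>

definition cross_domain :: "'a set \<Rightarrow> ('a \<times> 'a) set" where
  "cross_domain \<Omega> = UNIV - (- \<Omega>) \<times> (- \<Omega>)"

definition hoelder_quotient ::
    "('a::euclidean_space \<Rightarrow> 'a \<Rightarrow> real) \<Rightarrow> ('a \<Rightarrow> real) \<Rightarrow> 'a \<Rightarrow> 'a \<Rightarrow> real" where
  "hoelder_quotient s u x y = (u x - u y) / norm (x - y) powr s x y"

text \<open>The Luxemburg functional of a modular; its value is \<open>\<infinity>\<close> if no \<open>r\<close> is admissible.\<close>

definition luxemburg :: "(real \<Rightarrow> ennreal) \<Rightarrow> ennreal" where
  "luxemburg \<rho> = Inf {ennreal r | r. 0 < r \<and> \<rho> r \<le> 1}"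

definition gagliardo_seminorm ::
    "'a::euclidean_space set \<Rightarrow> ('a \<Rightarrow> 'a \<Rightarrow> real) \<Rightarrow> ('a \<Rightarrow> 'a \<Rightarrow> real \<Rightarrow> real) \<Rightarrow>
     ('a \<Rightarrow> real) \<Rightarrow> ennreal" where
  "gagliardo_seminorm \<Omega> s a u =
     luxemburg (\<lambda>r. \<integral>\<^sup>+ (x, y) \<in> cross_domain \<Omega>.
        ennreal (musielak_Phi a x y (\<bar>u x - u y\<bar> / (r * norm (x - y) powr s x y))
                 / norm (x - y) ^ DIM('a)) \<partial>lebesgue)"

definition interior_norm ::
    "'a::euclidean_space set \<Rightarrow> ('a \<Rightarrow> 'a \<Rightarrow> real \<Rightarrow> real) \<Rightarrow> ('a \<Rightarrow> real) \<Rightarrow> ennreal" where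
  "interior_norm \<Omega> a u =
     luxemburg (\<lambda>r. \<integral>\<^sup>+ x \<in> \<Omega>. ennreal (musielak_Phi_hat a x (\<bar>u x\<bar> / r)) \<partial>lebesgue)"

definition exterior_norm ::
    "'a::euclidean_space set \<Rightarrow> ('a \<Rightarrow> real) \<Rightarrow> ('a \<Rightarrow> 'a \<Rightarrow> real \<Rightarrow> real) \<Rightarrow>
     ('a \<Rightarrow> real) \<Rightarrow> ennreal" where
  "exterior_norm \<Omega> \<beta> a u =
     luxemburg (\<lambda>r. \<integral>\<^sup>+ x \<in> - \<Omega>. ennreal (\<beta> x * musielak_Phi_hat a x (\<bar>u x\<bar> / r)) \<partial>lebesgue)"

definition X_norm ::
    "'a::euclidean_space set \<Rightarrow> ('a \<Rightarrow> real) \<Rightarrow> ('a \<Rightarrow> 'a \<Rightarrow> real) \<Rightarrow>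
     ('a \<Rightarrow> 'a \<Rightarrow> real \<Rightarrow> real) \<Rightarrow> ('a \<Rightarrow> real) \<Rightarrow> ennreal" where
  "X_norm \<Omega> \<beta> s a u =
     gagliardo_seminorm \<Omega> s a u + interior_norm \<Omega> a u + exterior_norm \<Omega> \<beta> a u"

text \<open>
  Functions rather than classes modulo a.e. equality: the operators and integrals below do not
  depend, up to null sets, on the choice of a representative.
\<close>

definition X_space ::
    "'a::euclidean_space set \<Rightarrow> ('a \<Rightarrow> real) \<Rightarrow> ('a \<Rightarrow> 'a \<Rightarrow> real) \<Rightarrow>
     ('a \<Rightarrow> 'a \<Rightarrow> real \<Rightarrow> real) \<Rightarrow> ('a \<Rightarrow> real) set" where
  "X_space \<Omega> \<beta> s a = {u \<in> borel_measurable lebesgue. X_norm \<Omega> \<beta> s a u < \<infinity>}"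

definition nonlocal_kernel ::
    "('a::euclidean_space \<Rightarrow> 'a \<Rightarrow> real) \<Rightarrow> ('a \<Rightarrow> 'a \<Rightarrow> real \<Rightarrow> real) \<Rightarrow>
     ('a \<Rightarrow> real) \<Rightarrow> 'a \<Rightarrow> 'a \<Rightarrow> real" where
  "nonlocal_kernel s a u x y =
     a x y \<bar>hoelder_quotient s u x y\<bar> * hoelder_quotient s u x y
       * (1 / norm (x - y) powr (real DIM('a) + s x y))"

definition truncated_laplacian ::
    "('a::euclidean_space \<Rightarrow> 'a \<Rightarrow> real) \<Rightarrow> ('a \<Rightarrow> 'a \<Rightarrow> real \<Rightarrow> real) \<Rightarrow>
     ('a \<Rightarrow> real) \<Rightarrow> real \<Rightarrow> 'a \<Rightarrow> real" where
  "truncated_laplacian s a u \<epsilon> x = (LINT y : - ball x \<epsilon> | lebesgue. nonlocal_kernel s a u x y)"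

definition fractional_laplacian ::
    "('a::euclidean_space \<Rightarrow> 'a \<Rightarrow> real) \<Rightarrow> ('a \<Rightarrow> 'a \<Rightarrow> real \<Rightarrow> real) \<Rightarrow>
     ('a \<Rightarrow> real) \<Rightarrow> 'a \<Rightarrow> real" where
  "fractional_laplacian s a u x = Lim (at_right 0) (\<lambda>\<epsilon>. truncated_laplacian s a u \<epsilon> x)"

definition nonlocal_normal_derivative ::
    "'a::euclidean_space set \<Rightarrow> ('a \<Rightarrow> 'a \<Rightarrow> real) \<Rightarrow> ('a \<Rightarrow> 'a \<Rightarrow> real \<Rightarrow> real) \<Rightarrow>
     ('a \<Rightarrow> real) \<Rightarrow> 'a \<Rightarrow> real" where
  "nonlocal_normal_derivative \<Omega> s a u x = (LINT y : \<Omega> | lebesgue. nonlocal_kernel s a u x y)"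

text \<open>
  For arbitrary \<open>u\<close> and \<open>v\<close> of finite norm neither the pointwise principal value nor the integrals
  against \<open>v\<close> need exist, and mere pointwise existence of the principal value does not
  determine the pairing: for N = 1, \<open>\<Omega> = (-1,1)\<close>, \<open>a = 1\<close>, \<open>s = 3/4\<close> and \<open>u\<close> a smooth,
  compactly supported cut-off of \<open>|x|^(1/2)\<close> equal to it on \<open>[-2,2]\<close>, the pointwise principal
  value is a bounded function on \<open>\<Omega> - {0}\<close>, but the weak operator has in addition a nonzero
  Dirac mass at 0. The next predicate says that the pairings of the two operators with \<open>v\<close> make
  sense: the double integrals are absolutely convergent (off the diagonal for the principal
  value), and the principal value exists a.e. where \<open>v\<close> does not vanish and also in the sense of
  L^1 convergence on \<open>\<Omega>\<close> with weight \<open>|v|\<close>.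
\<close>

definition pairings_defined ::
    "'a::euclidean_space set \<Rightarrow> ('a \<Rightarrow> 'a \<Rightarrow> real) \<Rightarrow> ('a \<Rightarrow> 'a \<Rightarrow> real \<Rightarrow> real) \<Rightarrow>
     ('a \<Rightarrow> real) \<Rightarrow> ('a \<Rightarrow> real) \<Rightarrow> bool" where
  "pairings_defined \<Omega> s a u v \<longleftrightarrow>
     (\<forall>\<epsilon>>0. set_integrable lebesgue {(x, y). x \<in> \<Omega> \<and> y \<notin> ball x \<epsilon>}
              (\<lambda>(x, y). v x * nonlocal_kernel s a u x y)) \<and>
     set_integrable lebesgue ((- \<Omega>) \<times> \<Omega>) (\<lambda>(x, y). v x * nonlocal_kernel s a u x y) \<and>
     (AE x in lebesgue. x \<in> \<Omega> \<and> v x \<noteq> 0 \<longrightarrow>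
        (\<exists>l. ((\<lambda>\<epsilon>. truncated_laplacian s a u \<epsilon> x) \<longlongrightarrow> l) (at_right 0))) \<and>
     ((\<lambda>\<epsilon>. \<integral>\<^sup>+ x \<in> \<Omega>. ennreal (\<bar>v x\<bar> *
          \<bar>truncated_laplacian s a u \<epsilon> x - fractional_laplacian s a u x\<bar>) \<partial>lebesgue)
        \<longlongrightarrow> 0) (at_right 0)"

definition energy_integrand ::
    "('a::euclidean_space \<Rightarrow> 'a \<Rightarrow> real) \<Rightarrow> ('a \<Rightarrow> 'a \<Rightarrow> real \<Rightarrow> real) \<Rightarrow>
     ('a \<Rightarrow> real) \<Rightarrow> ('a \<Rightarrow> real) \<Rightarrow> 'a \<Rightarrow> 'a \<Rightarrow> real" where
  "energy_integrand s a u v x y =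
     a x y \<bar>hoelder_quotient s u x y\<bar> * hoelder_quotient s u x y * hoelder_quotient s v x y
       * (1 / norm (x - y) ^ DIM('a))"

end

theory Submission
  imports Defs
begin

text \<open>
  Since \<open>\<phi>\<close> is increasing, \<open>\<phi>(t) r \<le> \<phi>(t) t + \<phi>(r) r \<le> p (\<Phi>(t) + \<Phi>(r))\<close>; together with the growth
  bound \<open>\<Phi>(R t) \<le> R^p \<Phi>(t)\<close> for \<open>R \<ge> 1\<close>, finiteness of the Gagliardo seminorms makes the energy
  integrand integrable. This integrand is \<open>k(x,y) (v x - v y)\<close> with \<open>k\<close> antisymmetric. On
  \<open>|x - y| \<ge> \<epsilon>\<close> the term \<open>v x k(x,y)\<close> is integrable by itself, so swapping \<open>x\<close> and \<open>y\<close> turns half the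
  truncated energy into the integral of \<open>v x k(x,y)\<close>, which Fubini splits into an interior and an
  exterior part. Then \<open>\<epsilon> \<rightarrow> 0\<close>: dominated convergence handles the energy and the exterior part,
  the weighted L^1 convergence of the principal value the interior part.
\<close>

section \<open>Completed Lebesgue measure on products\<close>

text \<open>Completeness is decisive: the preimages of a Borel set under \<open>f\<close> and
  \<open>g\<close> differ by a subset of a null set, and a completion contains all such
  subsets.\<close>

lemma borel_measurable_completion_AE:
  fixes f g :: "'a \<Rightarrow> 'b::topological_space"
  assumes g: "g \<in> borel_measurable (completion M)"
    and eq: "AE x in completion M. f x = g x"
  shows "f \<in> borel_measurable (completion M)"
proof (rule measurableI)
  fix A :: "'b set" assume A: "A \<in> sets borel"
  show "f -` A \<inter> space (completion M) \<in> sets (completion M)"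
  proof (rule completion.in_sets_AE)
    show "g -` A \<inter> space (completion M) \<in> sets (completion M)"
      using g A by (rule measurable_sets)
    show "AE x in completion M.
        (x \<in> g -` A \<inter> space (completion M)) = (x \<in> f -` A \<inter> space (completion M))"
      using eq by eventually_elim simp
  qed simp
qed simp

text \<open>\<open>lebesgue\<close> on the product completes the Borel product, so measurability
  into \<open>lebesgue\<close> needs an argument on null sets: the cylinder over a null set is null,
  since 0 times infinity is 0 in the product formula.\<close>

lemma lebesgue_measurable_fst [measurable]:
  "(fst :: 'a::euclidean_space \<times> 'b::euclidean_space \<Rightarrow> 'a) \<in> lebesgue \<rightarrow>\<^sub>M lebesgue"
proof (rule completion.measurable_completion2)
  show meas: "(fst :: 'a \<times> 'b \<Rightarrow> 'a) \<in> lebesgue \<rightarrow>\<^sub>M (lborel :: 'a measure)"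
    by (intro measurable_completion) (simp add: borel_measurable_continuous_onI continuous_on_fst)
  show "null_sets lborel \<subseteq> null_sets (distr lebesgue lborel (fst :: 'a \<times> 'b \<Rightarrow> 'a))"
  proof
    fix N :: "'a set" assume N: "N \<in> null_sets lborel"
    have "fst -` N = N \<times> (UNIV :: 'b set)" by auto
    moreover have "N \<times> (UNIV :: 'b set) \<in> null_sets (lborel \<Otimes>\<^sub>M lborel)"
      using N by (auto simp: null_sets_def lborel.emeasure_pair_measure_Times)
    then have "N \<times> (UNIV :: 'b set) \<in> null_sets lebesgue"
      unfolding lborel_prod by (rule null_sets_completionI)
    ultimately show "N \<in> null_sets (distr lebesgue lborel (fst :: 'a \<times> 'b \<Rightarrow> 'a))"
      using N emeasure_distr[OF meas, of N] by (auto simp: null_sets_def)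
  qed
qed

text \<open>Invariance under the exchange of variables is known for the Borel product. Null sets
  therefore pull back to null sets, and both claims pass to the completion.\<close>

lemma lebesgue_measurable_swap:
  "prod.swap \<in> (lebesgue :: ('a::euclidean_space \<times> 'b::euclidean_space) measure) \<rightarrow>\<^sub>M lebesgue"
  and distr_lebesgue_swap:
  "distr (lebesgue :: ('a \<times> 'b) measure) lebesgue prod.swap = lebesgue"
proof -
  have cont: "continuous_on UNIV (prod.swap :: 'a \<times> 'b \<Rightarrow> 'b \<times> 'a)"
    by (simp add: prod.swap_def continuous_intros)
  have meas: "(prod.swap :: 'a \<times> 'b \<Rightarrow> 'b \<times> 'a) \<in> lborel \<rightarrow>\<^sub>M lborel"
    using borel_measurable_continuous_onI[OF cont] by simp
  have sw: "(prod.swap :: 'a \<times> 'b \<Rightarrow> 'b \<times> 'a) = (\<lambda>(x, y). (y, x))"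
    by auto
  have d: "distr lebesgue lborel (prod.swap :: 'a \<times> 'b \<Rightarrow> 'b \<times> 'a) = lborel"
    using lborel_pair.distr_pair_swap[where 'a='b and 'b='a]
    by (simp add: distr_completion[OF meas] lborel_prod flip: sw)
  have meas': "(prod.swap :: 'a \<times> 'b \<Rightarrow> 'b \<times> 'a) \<in> lebesgue \<rightarrow>\<^sub>M lborel"
    by (rule measurable_completion[OF meas])
  show "prod.swap \<in> (lebesgue :: ('a \<times> 'b) measure) \<rightarrow>\<^sub>M lebesgue"
    by (rule completion.measurable_completion2[OF meas']) (simp add: d)
  show "distr (lebesgue :: ('a \<times> 'b) measure) lebesgue prod.swap = lebesgue"
    using completion.completion_distr_eq[OF meas'] by (simp add: d)
qed

lemma
  fixes f :: "'a::euclidean_space \<times> 'b::euclidean_space \<Rightarrow> real"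
  assumes "integrable lebesgue f"
  shows integrable_lebesgue_swap: "integrable lebesgue (\<lambda>(x, y). f (y, x))"
    and integral_lebesgue_swap: "(LINT (x, y) | lebesgue. f (y, x)) = integral\<^sup>L lebesgue f"
proof -
  have sw: "(\<lambda>(x, y). f (y, x)) = (\<lambda>z. f (prod.swap z))"
    by auto
  note m = lebesgue_measurable_swap[where 'a='b and 'b='a]
  show "integrable lebesgue (\<lambda>(x, y). f (y, x))"
    using assms integrable_distr[OF m, of f] by (simp add: sw distr_lebesgue_swap)
  show "(LINT (x, y) | lebesgue. f (y, x)) = integral\<^sup>L lebesgue f"
    using assms integral_distr[OF m, of f] by (simp add: sw distr_lebesgue_swap)
qed

lemma lebesgue_measurable_snd [measurable]:
  "(snd :: 'a::euclidean_space \<times> 'b::euclidean_space \<Rightarrow> 'b) \<in> lebesgue \<rightarrow>\<^sub>M lebesgue"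
proof -
  have "(snd :: 'a \<times> 'b \<Rightarrow> 'b) = (\<lambda>z. fst (prod.swap z))"
    by auto
  then show ?thesis
    using measurable_compose[OF lebesgue_measurable_swap lebesgue_measurable_fst] by simp
qed

text \<open>The completed measure on the product is not the product of the completed factors, so
  Fubini is applied to a Borel representative \<open>g\<close> and the result is carried back along
  null sets.\<close>

lemma
  fixes f :: "'a::euclidean_space \<times> 'b::euclidean_space \<Rightarrow> real"
  assumes f: "integrable lebesgue f"
  shows integrable_lebesgue_fst: "integrable lebesgue (\<lambda>x. LINT y | lebesgue. f (x, y))"
    and integral_lebesgue_fst:
      "(LINT x | lebesgue. LINT y | lebesgue. f (x, y)) = integral\<^sup>L lebesgue f"
proof -
  obtain g where g: "g \<in> borel_measurable lborel" and eq: "AE z in lborel. f z = g z"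
    using completion_ex_borel_measurable_real[of f lborel] f by auto
  have ig: "integrable lebesgue g"
    using f g AE_completion[OF eq]
    by (subst integrable_cong_AE[of _ _ f]) (auto intro: measurable_completion)
  then have ig': "integrable (lborel \<Otimes>\<^sub>M lborel) g"
    using g by (simp add: integrable_completion lborel_prod)
  have "integral\<^sup>L lebesgue f = integral\<^sup>L lebesgue g"
    using f ig AE_completion[OF eq] by (intro integral_cong_AE) auto
  also have "\<dots> = integral\<^sup>L (lborel \<Otimes>\<^sub>M lborel) g"
    using g by (simp add: integral_completion lborel_prod)
  finally have fg: "integral\<^sup>L lebesgue f = integral\<^sup>L (lborel \<Otimes>\<^sub>M lborel) g" .
  have gx: "(\<lambda>y. g (x, y)) \<in> borel_measurable lborel" for x
    using g by (simp add: borel_prod[symmetric])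
  \<comment> \<open>The sections of \<open>f\<close> and \<open>g\<close> agree almost everywhere
    only for almost every \<open>x\<close>; for these \<open>x\<close> completeness makes the
    section of \<open>f\<close> measurable.\<close>
  have inner: "AE x in lborel. (LINT y | lebesgue. f (x, y)) = (LINT y | lborel. g (x, y))"
    using lborel_pair.AE_pair[of "\<lambda>z. f z = g z", unfolded lborel_prod, OF eq]
  proof eventually_elim
    case (elim x)
    have m: "(\<lambda>y. f (x, y)) \<in> borel_measurable lebesgue"
      using borel_measurable_completion_AE[OF measurable_completion[OF gx[of x]] AE_completion[OF elim]] .
    have "(LINT y | lebesgue. f (x, y)) = (LINT y | lebesgue. g (x, y))"
      using m gx[of x] AE_completion[OF elim]
      by (intro integral_cong_AE) (auto intro: measurable_completion)
    then show ?case
      using gx by (simp add: integral_completion)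
  qed
  have G: "integrable lborel (\<lambda>x. LINT y | lborel. g (x, y))"
    using lborel_pair.integrable_fst'[OF ig'] .
  then have G': "integrable lebesgue (\<lambda>x. LINT y | lborel. g (x, y))"
    by (subst integrable_completion) auto
  have M: "(\<lambda>x. LINT y | lebesgue. f (x, y)) \<in> borel_measurable lebesgue"
    by (rule borel_measurable_completion_AE[OF _ AE_completion[OF inner]]) (use G' in auto)
  show "integrable lebesgue (\<lambda>x. LINT y | lebesgue. f (x, y))"
    using G' M AE_completion[OF inner] by (subst integrable_cong_AE) auto
  have "(LINT x | lebesgue. LINT y | lebesgue. f (x, y))
      = (LINT x | lebesgue. LINT y | lborel. g (x, y))"
    using G' M AE_completion[OF inner] by (intro integral_cong_AE) auto
  also have "\<dots> = integral\<^sup>L (lborel \<Otimes>\<^sub>M lborel) g"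
    using G lborel_pair.integral_fst'[OF ig'] by (subst integral_completion) auto
  finally show "(LINT x | lebesgue. LINT y | lebesgue. f (x, y)) = integral\<^sup>L lebesgue f"
    by (simp add: fg)
qed

section \<open>Musielak functions and integrability of the energy\<close>

text \<open>If \<open>g\<close> takes countably many values, the composition reduces to fixed second
  arguments. A general \<open>g\<close> is a pointwise limit of such functions, and continuity of
  \<open>F z\<close> carries measurability to the limit.\<close>

lemma borel_measurable_caratheodory:
  fixes F :: "'a \<Rightarrow> real \<Rightarrow> real"
  assumes F: "\<And>t. 0 \<le> t \<Longrightarrow> (\<lambda>z. F z t) \<in> borel_measurable M"
    and cont: "\<And>z. continuous_on {0..} (F z)"
    and g [measurable]: "g \<in> borel_measurable M"
    and g_nonneg: "\<And>z. 0 \<le> g z"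
  shows "(\<lambda>z. F z (g z)) \<in> borel_measurable M"
proof (rule borel_measurable_LIMSEQ_real)
  \<comment> \<open>Rounding \<open>g\<close> down to multiples of \<open>1 / Suc n\<close> keeps
    the values nonnegative, where \<open>F z\<close> is continuous.\<close>
  define h where "h n z = real (nat \<lfloor>real (Suc n) * g z\<rfloor>) / real (Suc n)" for n z
  show "(\<lambda>z. F z (h n z)) \<in> borel_measurable M" for n
    unfolding h_def
  proof (rule measurable_compose_countable[where g="\<lambda>z. nat \<lfloor>real (Suc n) * g z\<rfloor>"])
    show "(\<lambda>z. F z (real k / real (Suc n))) \<in> borel_measurable M" for k :: nat
      by (rule F) simp
    show "(\<lambda>z. nat \<lfloor>real (Suc n) * g z\<rfloor>) \<in> measurable M (count_space UNIV)"
      by measurable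
  qed
  show "(\<lambda>n. F z (h n z)) \<longlonglongrightarrow> F z (g z)" for z
  proof (rule continuous_on_tendsto_compose[OF cont])
    have h_eq: "h n z = of_int \<lfloor>real (Suc n) * g z\<rfloor> / real (Suc n)" for n
      using g_nonneg[of z] by (simp add: h_def)
    have "\<bar>h n z - g z\<bar> \<le> 1 / real (Suc n)" for n
    proof -
      have "\<bar>of_int \<lfloor>real (Suc n) * g z\<rfloor> - real (Suc n) * g z\<bar> \<le> 1"
        by linarith
      then have "\<bar>(of_int \<lfloor>real (Suc n) * g z\<rfloor> - real (Suc n) * g z) / real (Suc n)\<bar> \<le> 1 / real (Suc n)"
        by (simp add: abs_divide divide_right_mono del: of_nat_Suc)
      moreover have "(of_int \<lfloor>real (Suc n) * g z\<rfloor> - real (Suc n) * g z) / real (Suc n) = h n z - g z"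
        by (simp add: h_eq diff_divide_distrib del: of_nat_Suc)
      ultimately show ?thesis by metis
    qed
    then have "(\<lambda>n. h n z - g z) \<longlonglongrightarrow> 0"
      by (intro Lim_null_comparison[OF _ LIMSEQ_inverse_real_of_nat])
         (auto simp: inverse_eq_divide)
    then show "(\<lambda>n. h n z) \<longlonglongrightarrow> g z"
      by (simp add: LIM_zero_iff)
  qed (auto simp: g_nonneg h_def)
qed

section \<open>Monotonicity, growth and measurability of the Musielak functions\<close>

locale musielak =
  fixes a :: "'a::euclidean_space \<Rightarrow> 'a \<Rightarrow> real \<Rightarrow> real" and m p :: real
  assumes musielak_structure: "musielak_structure a m p"
begin

lemma a_commute: "a x y t = a y x t"
  using musielak_structure by (auto simp: musielak_structure_def)

lemma a_abs_mult: "a x y \<bar>t\<bar> * t = musielak_phi a x y t"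
  by (simp add: musielak_phi_def)

lemma musielak_phi_minus: "musielak_phi a x y (- t) = - musielak_phi a x y t"
  by (simp add: musielak_phi_def)

lemma abs_musielak_phi: "\<bar>musielak_phi a x y t\<bar> = musielak_phi a x y \<bar>t\<bar>"
proof -
  have "0 \<le> musielak_phi a x y \<bar>t\<bar>"
    using musielak_structure strict_mono_mono[of "musielak_phi a x y"] monoD[of "musielak_phi a x y" 0 "\<bar>t\<bar>"]
    by (simp add: musielak_structure_def musielak_phi_def)
  then show ?thesis
    by (cases "0 \<le> t") (use musielak_phi_minus[of x y t] in auto)
qed

text \<open>Moves the sign out of the argument, so that the Caratheodory composition lemma, which
  requires a nonnegative inner function, covers signed difference quotients.\<close>

lemma musielak_phi_eq_sgn_mult: "musielak_phi a x y t = sgn t * musielak_phi a x y \<bar>t\<bar>"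
  using musielak_phi_minus[of x y t] by (cases "0 \<le> t") (auto simp: sgn_if musielak_phi_def)

lemma mono_musielak_phi: "mono (musielak_phi a x y)"
  using musielak_structure by (auto simp: musielak_structure_def strict_mono_mono)

lemma musielak_phi_nonneg: "0 \<le> t \<Longrightarrow> 0 \<le> musielak_phi a x y t"
  using abs_musielak_phi[of x y t] by simp

lemma continuous_on_musielak_phi: "continuous_on A (musielak_phi a x y)"
proof -
  have "continuous_on UNIV (musielak_phi a x y)"
    using musielak_structure by (auto simp: musielak_structure_def homeomorphism_def)
  then show ?thesis
    by (rule continuous_on_subset) simp
qed

lemma musielak_phi_integrable: "musielak_phi a x y integrable_on {s..t}"
  by (rule integrable_continuous_real[OF continuous_on_musielak_phi])

lemma has_derivative_musielak_Phi:
  assumes "0 \<le> t"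
  shows "(musielak_Phi a x y has_real_derivative musielak_phi a x y t) (at t within {0..})"
proof -
  have "(musielak_Phi a x y has_real_derivative musielak_phi a x y t) (at t within {0..t + 1})"
    unfolding musielak_Phi_def
    by (rule integral_has_real_derivative[OF continuous_on_musielak_phi]) (use assms in auto)
  \<comment> \<open>The fundamental theorem of calculus works on a compact interval; near
    \<open>t\<close> the interval and the half-line coincide.\<close>
  moreover have "at t within {0..t + 1} = at t within {0..}"
    by (rule at_within_nhd[of _ "{..<t + 1}"]) auto
  ultimately show ?thesis by simp
qed

lemma continuous_on_musielak_Phi: "continuous_on {0..} (musielak_Phi a x y)"
  using has_derivative_musielak_Phi
  by (intro DERIV_continuous_on[where D="musielak_phi a x y"]) auto

lemma musielak_Phi_nonneg: "0 \<le> musielak_Phi a x y t"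
  unfolding musielak_Phi_def
  by (rule integral_nonneg[OF musielak_phi_integrable]) (auto simp: musielak_phi_nonneg)

lemma musielak_Phi_mono: "s \<le> t \<Longrightarrow> musielak_Phi a x y s \<le> musielak_Phi a x y t"
  unfolding musielak_Phi_def
  by (rule integral_subset_le) (auto simp: musielak_phi_integrable musielak_phi_nonneg)

text \<open>The lower bound on the quotient excludes \<open>\<Phi> = 0\<close>, where the quotient is \<open>0\<close> by convention.\<close>

lemma mult_musielak_phi_le:
  assumes "0 \<le> t"
  shows "t * musielak_phi a x y t \<le> p * musielak_Phi a x y t"
proof (cases "t = 0")
  case False
  then have *: "1 < m" "m \<le> t * musielak_phi a x y t / musielak_Phi a x y t"
    "t * musielak_phi a x y t / musielak_Phi a x y t \<le> p"
    using assms musielak_structure by (auto simp: musielak_structure_def)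
  then have "musielak_Phi a x y t \<noteq> 0" by auto
  then have "0 < musielak_Phi a x y t"
    using musielak_Phi_nonneg[of x y t] by simp
  then show ?thesis
    using * by (simp add: divide_simps)
qed (simp add: musielak_Phi_def)

text \<open>The bound \<open>\<tau> * \<phi>(\<tau>) <= p * \<Phi>(\<tau>)\<close> says that
  \<open>\<Phi>(\<tau>) * \<tau> powr (- p)\<close> has nonpositive derivative for positive
  \<open>\<tau>\<close>; comparing its values at \<open>t\<close> and \<open>r * t\<close> gives the
  claim.\<close>

lemma musielak_Phi_growth:
  assumes "1 \<le> r" "0 \<le> t"
  shows "musielak_Phi a x y (r * t) \<le> r powr p * musielak_Phi a x y t"
proof (cases "t = 0")
  case False
  with assms have t: "0 < t" by simp
  let ?h = "\<lambda>\<tau>. musielak_Phi a x y \<tau> * \<tau> powr (- p)"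
  have "?h (r * t) \<le> ?h t"
  proof (rule DERIV_nonpos_imp_nonincreasing[where f="?h"])
    show "t \<le> r * t" using assms t by simp
    fix \<tau> assume "t \<le> \<tau>" "\<tau> \<le> r * t"
    with t have \<tau>: "0 < \<tau>" by simp
    have "(musielak_Phi a x y has_real_derivative musielak_phi a x y \<tau>) (at \<tau>)"
      using has_derivative_musielak_Phi[of \<tau>] \<tau> at_within_interior[of \<tau> "{0..}"] by simp
    then have "(?h has_real_derivative
        (musielak_phi a x y \<tau> * \<tau> powr (- p) + (- p * \<tau> powr (- p - 1)) * musielak_Phi a x y \<tau>)) (at \<tau>)"
      using \<tau> by (intro DERIV_mult has_real_derivative_powr)
    moreover have "musielak_phi a x y \<tau> * \<tau> powr (- p) + (- p * \<tau> powr (- p - 1)) * musielak_Phi a x y \<tau>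
        = \<tau> powr (- p - 1) * (\<tau> * musielak_phi a x y \<tau> - p * musielak_Phi a x y \<tau>)"
      using \<tau> by (simp add: powr_diff field_simps)
    moreover have "\<dots> \<le> 0"
      using mult_musielak_phi_le[of \<tau> x y] \<tau> by (intro mult_nonneg_nonpos) auto
    ultimately show "\<exists>D. (?h has_real_derivative D) (at \<tau>) \<and> D \<le> 0"
      by metis
  qed
  then show ?thesis
    using assms t by (simp add: powr_minus powr_mult field_simps)
qed (simp add: musielak_Phi_def)

text \<open>Only the measurability of \<open>\<Phi>\<close> is given; \<open>\<phi>\<close> inherits it as the right derivative of \<open>\<Phi>\<close>.\<close>

lemma borel_measurable_musielak_Phi:
  assumes "0 \<le> t" shows "(\<lambda>z. musielak_Phi a (fst z) (snd z) t) \<in> borel_measurable lebesgue"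
  using musielak_structure assms by (auto simp: musielak_structure_def split_def)

lemma borel_measurable_musielak_phi:
  assumes t: "0 \<le> t" shows "(\<lambda>z. musielak_phi a (fst z) (snd z) t) \<in> borel_measurable lebesgue"
proof (rule borel_measurable_LIMSEQ_real)
  let ?Q = "\<lambda>n z. (musielak_Phi a (fst z) (snd z) (t + inverse (real (Suc n)))
                   - musielak_Phi a (fst z) (snd z) t) / inverse (real (Suc n))"
  show "?Q n \<in> borel_measurable lebesgue" for n
    using borel_measurable_musielak_Phi[OF t]
      borel_measurable_musielak_Phi[of "t + inverse (real (Suc n))"] t
    by (intro borel_measurable_divide borel_measurable_diff) auto
  show "(\<lambda>n. ?Q n z) \<longlonglongrightarrow> musielak_phi a (fst z) (snd z) t" for z
  proof -
    have "((\<lambda>\<tau>. (musielak_Phi a (fst z) (snd z) \<tau> - musielak_Phi a (fst z) (snd z) t) / (\<tau> - t))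
        \<longlongrightarrow> musielak_phi a (fst z) (snd z) t) (at t within {0..})"
      using has_derivative_musielak_Phi[OF t] by (simp add: has_field_derivative_iff)
    \<comment> \<open>The points approach \<open>t\<close> from the right, hence differ from
      \<open>t\<close> and stay in the half-line even for \<open>t = 0\<close>.\<close>
    moreover have "filterlim (\<lambda>n. t + inverse (real (Suc n))) (at t within {0..}) sequentially"
      using LIMSEQ_inverse_real_of_nat_add[of t] t
      by (auto simp: filterlim_at intro!: always_eventually add_nonneg_nonneg)
    ultimately show ?thesis
      by (auto dest: filterlim_compose)
  qed
qed

end

section \<open>Difference quotients and the Luxemburg functional\<close>

lemma borel_measurable_hoelder_quotient:
  assumes s: "continuous_on UNIV (\<lambda>(x, y). s x y)" and u: "u \<in> borel_measurable lebesgue"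
  shows "(\<lambda>z. hoelder_quotient s u (fst z) (snd z)) \<in> borel_measurable lebesgue"
proof -
  have "(\<lambda>(x, y). s x y) \<in> borel_measurable lebesgue"
    using s by (intro measurable_completion) (simp add: borel_measurable_continuous_onI)
  then have [measurable]: "(\<lambda>z. s (fst z) (snd z)) \<in> borel_measurable lebesgue"
    by (simp add: split_def)
  have [measurable]: "(\<lambda>z::'a \<times> 'a. norm (fst z - snd z)) \<in> borel_measurable lebesgue"
    by (intro measurable_completion) (auto intro!: borel_measurable_continuous_onI continuous_intros)
  \<comment> \<open>Since \<open>u\<close> is Lebesgue but perhaps not Borel measurable, these
    compositions rely on the projections being measurable between the completed measures.\<close>
  note [measurable] = measurable_compose[OF lebesgue_measurable_fst u]
    measurable_compose[OF lebesgue_measurable_snd u]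
  show ?thesis
    unfolding hoelder_quotient_def by measurable
qed

text \<open>The infimum of the empty set is infinity, so a finite value supplies at least one
  admissible scale.\<close>

lemma luxemburg_finiteD:
  assumes "luxemburg \<rho> < \<infinity>"
  obtains r where "0 < r" "\<rho> r \<le> 1"
proof -
  have "{ennreal r | r. 0 < r \<and> \<rho> r \<le> 1} \<noteq> {}"
  proof
    assume "{ennreal r | r. 0 < r \<and> \<rho> r \<le> 1} = {}"
    then have "luxemburg \<rho> = \<infinity>"
      unfolding luxemburg_def by (simp only: Inf_empty infinity_ennreal_def)
    with assms show False by simp
  qed
  then show ?thesis using that by auto
qed

lemma sets_cross_domain:
  fixes \<Omega> :: "'a::euclidean_space set"
  assumes "open \<Omega>" shows "cross_domain \<Omega> \<in> sets lebesgue"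
proof -
  have "closed ((- \<Omega>) \<times> (- \<Omega>))"
    using assms by (intro closed_Times) auto
  then have "open (cross_domain \<Omega>)"
    by (auto simp: cross_domain_def Compl_eq_Diff_UNIV[symmetric])
  then show ?thesis by simp
qed

section \<open>Integrability of the modular density and of the energy density\<close>

context musielak
begin

text \<open>A finite seminorm controls the modular only at some scale \<open>r\<close>; the growth
  bound trades this scale for the constant factor \<open>R powr p\<close> and gives integrability at
  scale 1.\<close>

lemma integrable_musielak_Phi_hoelder_quotient:
  fixes s :: "'a \<Rightarrow> 'a \<Rightarrow> real"
  assumes \<Omega>: "open \<Omega>" and s: "continuous_on UNIV (\<lambda>(x, y). s x y)"
    and u: "u \<in> borel_measurable lebesgue" and fin: "gagliardo_seminorm \<Omega> s a u < \<infinity>"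
  shows "set_integrable lebesgue (cross_domain \<Omega>)
    (\<lambda>z. musielak_Phi a (fst z) (snd z) \<bar>hoelder_quotient s u (fst z) (snd z)\<bar>
         / norm (fst z - snd z) ^ DIM('a))"
    (is "set_integrable _ ?D _")
proof -
  note q [measurable] = borel_measurable_hoelder_quotient[OF s u]
  let ?F = "\<lambda>r z. musielak_Phi a (fst z) (snd z) (\<bar>hoelder_quotient s u (fst z) (snd z)\<bar> / r)
                 / norm (fst z - snd z) ^ DIM('a)"
  have F [measurable]: "?F r \<in> borel_measurable lebesgue" if "0 < r" for r
  proof -
    have "(\<lambda>z. musielak_Phi a (fst z) (snd z) (\<bar>hoelder_quotient s u (fst z) (snd z)\<bar> / r))
        \<in> borel_measurable lebesgue"
      by (rule borel_measurable_caratheodory)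
         (use that in \<open>auto simp: borel_measurable_musielak_Phi continuous_on_musielak_Phi\<close>)
    moreover have "(\<lambda>z::'a \<times> 'a. norm (fst z - snd z) ^ DIM('a)) \<in> borel_measurable lebesgue"
      by (intro measurable_completion) (auto intro!: borel_measurable_continuous_onI continuous_intros)
    ultimately show ?thesis
      by measurable
  qed
  note D [measurable] = sets_cross_domain[OF \<Omega>]
  obtain r where r: "0 < r" and "(\<integral>\<^sup>+ (x, y) \<in> ?D.
        ennreal (musielak_Phi a x y (\<bar>u x - u y\<bar> / (r * norm (x - y) powr s x y))
                 / norm (x - y) ^ DIM('a)) \<partial>lebesgue) \<le> 1"
    using luxemburg_finiteD[OF fin[unfolded gagliardo_seminorm_def]] .
  then have le: "(\<integral>\<^sup>+ z \<in> ?D. ennreal (?F r z) \<partial>lebesgue) \<le> 1"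
    by (simp add: hoelder_quotient_def abs_divide case_prod_unfold mult.commute)
  \<comment> \<open>The growth bound needs a factor of at least 1, and dividing the quotient by
    \<open>R\<close> instead of \<open>r\<close> must not increase \<open>\<Phi>\<close>; the
    maximum serves both.\<close>
  define R where "R = max 1 r"
  have R: "1 \<le> R" "r \<le> R" by (auto simp: R_def)
  have bound: "?F 1 z \<le> R powr p * ?F r z" for z
  proof -
    obtain x y where z: "z = (x, y)" by (cases z)
    let ?q = "\<bar>hoelder_quotient s u x y\<bar>"
    have "musielak_Phi a x y ?q = musielak_Phi a x y (R * (?q / R))"
      using R by simp
    also have "\<dots> \<le> R powr p * musielak_Phi a x y (?q / R)"
      using R by (intro musielak_Phi_growth) auto
    also have "\<dots> \<le> R powr p * musielak_Phi a x y (?q / r)"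
      using R r by (intro mult_left_mono musielak_Phi_mono divide_left_mono) auto
    finally have "musielak_Phi a x y ?q / norm (x - y) ^ DIM('a)
        \<le> R powr p * musielak_Phi a x y (?q / r) / norm (x - y) ^ DIM('a)"
      by (rule divide_right_mono) simp
    then show ?thesis
      by (simp add: z)
  qed
  have "(\<integral>\<^sup>+ z. ennreal (norm (indicator ?D z *\<^sub>R ?F 1 z)) \<partial>lebesgue)
      \<le> (\<integral>\<^sup>+ z. ennreal (R powr p) * (ennreal (?F r z) * indicator ?D z) \<partial>lebesgue)"
    using bound
    by (intro nn_integral_mono)
       (auto simp: indicator_def musielak_Phi_nonneg ennreal_mult'[symmetric] intro!: ennreal_leI)
  also have "\<dots> = ennreal (R powr p) * (\<integral>\<^sup>+ z \<in> ?D. ennreal (?F r z) \<partial>lebesgue)"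
    using F[OF r] D by (intro nn_integral_cmult) auto
  also have "\<dots> \<le> ennreal (R powr p) * 1"
    using le by (intro mult_left_mono) simp_all
  also have "\<dots> < \<infinity>" by simp
  finally have finite: "(\<integral>\<^sup>+ z. ennreal (norm (indicator ?D z *\<^sub>R ?F 1 z)) \<partial>lebesgue) < \<infinity>" .
  have "set_integrable lebesgue ?D (?F 1)"
    unfolding set_integrable_def
    by (rule integrableI_bounded[OF borel_measurable_scaleR[OF borel_measurable_indicator[OF D] F] finite]) simp
  then show ?thesis by simp
qed

text \<open>Domination by the modular densities of \<open>u\<close> and \<open>v\<close> takes the
  place of Young's inequality with a conjugate function.\<close>

lemma set_integrable_energy_integrand:
  fixes s :: "'a \<Rightarrow> 'a \<Rightarrow> real"
  assumes \<Omega>: "open \<Omega>" and s: "continuous_on UNIV (\<lambda>(x, y). s x y)"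
    and u: "u \<in> borel_measurable lebesgue" "gagliardo_seminorm \<Omega> s a u < \<infinity>"
    and v: "v \<in> borel_measurable lebesgue" "gagliardo_seminorm \<Omega> s a v < \<infinity>"
  shows "set_integrable lebesgue (cross_domain \<Omega>) (\<lambda>(x, y). energy_integrand s a u v x y)"
proof -
  let ?n = "\<lambda>z::'a \<times> 'a. norm (fst z - snd z) ^ DIM('a)"
  let ?q = "\<lambda>w z. hoelder_quotient s w (fst z) (snd z)"
  let ?\<phi> = "\<lambda>z. musielak_phi a (fst z) (snd z)"
  let ?\<Phi> = "\<lambda>w z. musielak_Phi a (fst z) (snd z) \<bar>?q w z\<bar> / ?n z"
  note [measurable] = borel_measurable_hoelder_quotient[OF s u(1)]
    borel_measurable_hoelder_quotient[OF s v(1)]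
  have E: "(\<lambda>(x, y). energy_integrand s a u v x y) = (\<lambda>z. sgn (?q u z) * ?\<phi> z \<bar>?q u z\<bar> * ?q v z / ?n z)"
    by (simp add: fun_eq_iff energy_integrand_def a_abs_mult musielak_phi_eq_sgn_mult[symmetric])
  have [measurable]: "(\<lambda>z. ?\<phi> z \<bar>?q u z\<bar>) \<in> borel_measurable lebesgue"
    by (rule borel_measurable_caratheodory)
       (auto simp: borel_measurable_musielak_phi continuous_on_musielak_phi)
  have [measurable]: "?n \<in> borel_measurable lebesgue"
    by (intro measurable_completion) (auto intro!: borel_measurable_continuous_onI continuous_intros)
  have meas: "(\<lambda>(x, y). energy_integrand s a u v x y) \<in> borel_measurable lebesgue"
    unfolding E by measurable
  have bound: "\<bar>energy_integrand s a u v (fst z) (snd z)\<bar> \<le> p * (?\<Phi> u z + ?\<Phi> v z)" for z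
  proof -
    \<comment> \<open>Replacing the smaller of the two quotients by the larger one leaves one of the
      two summands on the right; the other summand is nonnegative.\<close>
    have "\<bar>?q v z\<bar> * ?\<phi> z \<bar>?q u z\<bar> \<le> \<bar>?q u z\<bar> * ?\<phi> z \<bar>?q u z\<bar> + \<bar>?q v z\<bar> * ?\<phi> z \<bar>?q v z\<bar>"
    proof (cases "\<bar>?q u z\<bar> \<le> \<bar>?q v z\<bar>")
      case True
      then have "\<bar>?q v z\<bar> * ?\<phi> z \<bar>?q u z\<bar> \<le> \<bar>?q v z\<bar> * ?\<phi> z \<bar>?q v z\<bar>"
        using monoD[OF mono_musielak_phi] by (intro mult_left_mono) auto
      then show ?thesis
        using musielak_phi_nonneg[of "\<bar>?q u z\<bar>" "fst z" "snd z"] by (simp add: add_increasing)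
    next
      case False
      then have "\<bar>?q v z\<bar> * ?\<phi> z \<bar>?q u z\<bar> \<le> \<bar>?q u z\<bar> * ?\<phi> z \<bar>?q u z\<bar>"
        by (intro mult_right_mono) (auto simp: musielak_phi_nonneg)
      then show ?thesis
        using musielak_phi_nonneg[of "\<bar>?q v z\<bar>" "fst z" "snd z"] by (simp add: add_increasing2)
    qed
    also have "\<dots> \<le> p * musielak_Phi a (fst z) (snd z) \<bar>?q u z\<bar> + p * musielak_Phi a (fst z) (snd z) \<bar>?q v z\<bar>"
      by (intro add_mono mult_musielak_phi_le) auto
    finally have "\<bar>?q v z\<bar> * ?\<phi> z \<bar>?q u z\<bar> / ?n z
        \<le> (p * musielak_Phi a (fst z) (snd z) \<bar>?q u z\<bar> + p * musielak_Phi a (fst z) (snd z) \<bar>?q v z\<bar>) / ?n z"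
      by (rule divide_right_mono) simp
    moreover have "\<bar>energy_integrand s a u v (fst z) (snd z)\<bar> = \<bar>?q v z\<bar> * ?\<phi> z \<bar>?q u z\<bar> / ?n z"
      by (simp add: energy_integrand_def a_abs_mult abs_mult abs_musielak_phi power_abs)
    ultimately show ?thesis
      by (simp add: algebra_simps add_divide_distrib)
  qed
  have "set_integrable lebesgue (cross_domain \<Omega>) (\<lambda>z. p * (?\<Phi> u z + ?\<Phi> v z))"
    using integrable_musielak_Phi_hoelder_quotient[OF \<Omega> s u]
      integrable_musielak_Phi_hoelder_quotient[OF \<Omega> s v]
    by (intro set_integrable_mult_right set_integral_add)
  then show ?thesis
  proof (rule set_integrable_bound)
    show "set_borel_measurable lebesgue (cross_domain \<Omega>) (\<lambda>(x, y). energy_integrand s a u v x y)"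
      unfolding set_borel_measurable_def using meas sets_cross_domain[OF \<Omega>] by measurable
    have "norm (case z of (x, y) \<Rightarrow> energy_integrand s a u v x y) \<le> norm (p * (?\<Phi> u z + ?\<Phi> v z))" for z
      using bound[of z] by (simp add: case_prod_unfold)
    then show "AE z in lebesgue. z \<in> cross_domain \<Omega> \<longrightarrow>
        norm (case z of (x, y) \<Rightarrow> energy_integrand s a u v x y) \<le> norm (p * (?\<Phi> u z + ?\<Phi> v z))"
      by simp
  qed
qed

end

section \<open>Antisymmetric kernels\<close>

lemma
  fixes K :: "'a::euclidean_space \<Rightarrow> 'b::euclidean_space \<Rightarrow> real" and v :: "'a \<Rightarrow> real"
  assumes "set_integrable lebesgue {(x, y). x \<in> S \<and> y \<in> B x} (\<lambda>(x, y). v x * K x y)"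
  shows set_integrable_weighted_section:
      "set_integrable lebesgue S (\<lambda>x. v x * (LINT y : B x | lebesgue. K x y))"
    and set_integral_weighted_section:
      "(LINT x : S | lebesgue. v x * (LINT y : B x | lebesgue. K x y))
        = (LINT (x, y) : {(x, y). x \<in> S \<and> y \<in> B x} | lebesgue. v x * K x y)"
proof -
  let ?f = "\<lambda>z. indicator {(x, y). x \<in> S \<and> y \<in> B x} z *\<^sub>R (case z of (x, y) \<Rightarrow> v x * K x y)"
  have f: "integrable lebesgue ?f"
    using assms by (simp add: set_integrable_def)
  \<comment> \<open>Neither the weight nor the indicator of \<open>S\<close> depends on
    \<open>y\<close>. The equation holds for every \<open>x\<close>, because a Bochner integral that
    does not exist has the value 0.\<close>
  have inner: "(LINT y | lebesgue. ?f (x, y)) = indicator S x *\<^sub>R (v x * (LINT y : B x | lebesgue. K x y))" for x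
  proof -
    have "?f (x, y) = (indicator S x * v x) * (indicator (B x) y *\<^sub>R K x y)" for y
      by (simp add: indicator_def)
    then have "(LINT y | lebesgue. ?f (x, y)) = (LINT y | lebesgue. (indicator S x * v x) * (indicator (B x) y *\<^sub>R K x y))"
      by presburger
    then show ?thesis
      by (simp add: set_lebesgue_integral_def)
  qed
  show "set_integrable lebesgue S (\<lambda>x. v x * (LINT y : B x | lebesgue. K x y))"
    using integrable_lebesgue_fst[OF f] unfolding inner set_integrable_def .
  show "(LINT x : S | lebesgue. v x * (LINT y : B x | lebesgue. K x y))
      = (LINT (x, y) : {(x, y). x \<in> S \<and> y \<in> B x} | lebesgue. v x * K x y)"
    using integral_lebesgue_fst[OF f] unfolding inner set_lebesgue_integral_def .
qed

section \<open>Limits of truncated integrals\<close>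

lemma sets_lebesgue_off_diagonal:
  "{z :: 'a::euclidean_space \<times> 'a. \<epsilon> \<le> dist (fst z) (snd z)} \<in> sets lebesgue"
proof -
  have "closed {z :: 'a \<times> 'a. \<epsilon> \<le> dist (fst z) (snd z)}"
    by (intro closed_Collect_le continuous_intros)
  then show ?thesis by simp
qed

text \<open>Dominated convergence with majorant \<open>|f|\<close> on \<open>S\<close>. The
  truncated sets may miss the diagonal for every \<open>n\<close>; since \<open>f\<close> vanishes
  there, the integrands still converge at every point.\<close>

lemma set_integral_off_diagonal_LIMSEQ:
  fixes f :: "'a::euclidean_space \<times> 'a \<Rightarrow> real"
  assumes f: "set_integrable lebesgue S f" and diag: "\<And>x. (x, x) \<in> S \<Longrightarrow> f (x, x) = 0"
    and \<epsilon>: "\<epsilon> \<longlonglongrightarrow> 0"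
  shows "(\<lambda>n. LINT z : S \<inter> {z. \<epsilon> n \<le> dist (fst z) (snd z)} | lebesgue. f z)
    \<longlonglongrightarrow> (LINT z : S | lebesgue. f z)"
  unfolding set_lebesgue_integral_def
proof (rule integral_dominated_convergence)
  let ?F = "\<lambda>z. indicator S z *\<^sub>R f z"
  let ?O = "\<lambda>n. {z :: 'a \<times> 'a. \<epsilon> n \<le> dist (fst z) (snd z)}"
  have split: "indicator (S \<inter> ?O n) z *\<^sub>R f z = indicator (?O n) z *\<^sub>R ?F z" for n z
    by (auto simp: indicator_def)
  have F: "integrable lebesgue ?F"
    using f unfolding set_integrable_def .
  show "?F \<in> borel_measurable lebesgue"
    using F by (rule borel_measurable_integrable)
  show "integrable lebesgue (\<lambda>z. norm (?F z))"
    using F by (rule Bochner_Integration.integrable_norm)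
  show "(\<lambda>z. indicator (S \<inter> ?O n) z *\<^sub>R f z) \<in> borel_measurable lebesgue" for n
    unfolding split
    by (intro borel_measurable_scaleR borel_measurable_indicator sets_lebesgue_off_diagonal
          borel_measurable_integrable F)
  show "AE z in lebesgue. norm (indicator (S \<inter> ?O n) z *\<^sub>R f z) \<le> norm (?F z)" for n
    by (simp add: indicator_def)
  have "(\<lambda>n. indicator (S \<inter> ?O n) z *\<^sub>R f z) \<longlonglongrightarrow> ?F z" for z
  proof (cases "fst z = snd z \<or> z \<notin> S")
    case True
    then have zero: "?F z = 0"
      using diag[of "fst z"] by (cases z) (auto simp: indicator_def)
    show ?thesis
      unfolding split zero by simp
  next
    case False
    then have "\<forall>\<^sub>F n in sequentially. \<epsilon> n < dist (fst z) (snd z)"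
      by (intro order_tendstoD(2)[OF \<epsilon>]) simp
    then have "\<forall>\<^sub>F n in sequentially. indicator (S \<inter> ?O n) z *\<^sub>R f z = ?F z"
      by eventually_elim (simp add: indicator_def)
    then show ?thesis
      by (rule tendsto_eventually)
  qed
  then show "AE z in lebesgue. (\<lambda>n. indicator (S \<inter> ?O n) z *\<^sub>R f z) \<longlonglongrightarrow> ?F z"
    by simp
qed

text \<open>The pointwise limit makes \<open>w x * L x\<close> measurable on \<open>S\<close>; a
  finite L^1 distance to one approximant then makes it integrable, and the L^1 convergence yields
  that of the integrals.\<close>

lemma
  fixes w L :: "'a::euclidean_space \<Rightarrow> real" and T :: "nat \<Rightarrow> 'a \<Rightarrow> real"
  assumes int: "\<And>n. set_integrable lebesgue S (\<lambda>x. w x * T n x)"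
    and conv: "AE x in lebesgue. x \<in> S \<and> w x \<noteq> 0 \<longrightarrow> (\<lambda>n. T n x) \<longlonglongrightarrow> L x"
    and L1: "(\<lambda>n. \<integral>\<^sup>+ x \<in> S. ennreal (\<bar>w x\<bar> * \<bar>T n x - L x\<bar>) \<partial>lebesgue) \<longlonglongrightarrow> 0"
  shows set_integrable_weighted_L1_limit: "set_integrable lebesgue S (\<lambda>x. w x * L x)"
    and set_integral_weighted_L1_limit:
      "(\<lambda>n. LINT x : S | lebesgue. w x * T n x) \<longlonglongrightarrow> (LINT x : S | lebesgue. w x * L x)"
proof -
  let ?g = "\<lambda>n x. indicator S x *\<^sub>R (w x * T n x)"
  let ?l = "\<lambda>x. indicator S x *\<^sub>R (w x * L x)"
  have g: "integrable lebesgue (?g n)" for n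
    using int by (simp add: set_integrable_def)
  \<comment> \<open>Outside \<open>S\<close> and where \<open>w\<close> vanishes both sides are 0,
    so convergence of \<open>T n x\<close> matters only at the remaining points.\<close>
  have "AE x in lebesgue. ?l x = lim (\<lambda>n. ?g n x)"
    using conv
  proof eventually_elim
    case (elim x)
    have "(\<lambda>n. ?g n x) \<longlonglongrightarrow> ?l x"
    proof (cases "x \<in> S \<and> w x \<noteq> 0")
      case True
      with elim show ?thesis by (intro tendsto_intros) auto
    qed auto
    then show ?case by (simp add: limI)
  qed
  then have l: "?l \<in> borel_measurable lebesgue"
    by (rule borel_measurable_completion_AE[rotated])
       (use g in \<open>intro borel_measurable_lim_metric, auto\<close>)
  have "norm (?g n x - ?l x) = indicator S x * (\<bar>w x\<bar> * \<bar>T n x - L x\<bar>)" for n x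
    by (simp add: indicator_def abs_mult[symmetric] right_diff_distrib)
  then have norm_eq: "ennreal (norm (?g n x - ?l x)) = ennreal (\<bar>w x\<bar> * \<bar>T n x - L x\<bar>) * indicator S x" for n x
    by (simp add: indicator_def)
  have L1': "(\<lambda>n. \<integral>\<^sup>+ x. ennreal (norm (?g n x - ?l x)) \<partial>lebesgue) \<longlonglongrightarrow> 0"
    unfolding norm_eq by (rule L1)
  then have "\<forall>\<^sub>F n in sequentially. (\<integral>\<^sup>+ x. ennreal (norm (?g n x - ?l x)) \<partial>lebesgue) < 1"
    by (rule order_tendstoD) simp
  then obtain n where n: "(\<integral>\<^sup>+ x. ennreal (norm (?g n x - ?l x)) \<partial>lebesgue) < 1"
    by (auto simp: eventually_sequentially)
  have "integrable lebesgue (\<lambda>x. ?g n x - ?l x)"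
  proof (rule integrableI_bounded)
    show "(\<lambda>x. ?g n x - ?l x) \<in> borel_measurable lebesgue"
      using g l by (intro borel_measurable_diff) auto
    show "(\<integral>\<^sup>+ x. ennreal (norm (?g n x - ?l x)) \<partial>lebesgue) < \<infinity>"
      using n by (rule less_trans) simp
  qed
  from Bochner_Integration.integrable_diff[OF g[of n] this]
  have li: "integrable lebesgue ?l" by simp
  then show "set_integrable lebesgue S (\<lambda>x. w x * L x)"
    by (simp add: set_integrable_def)
  show "(\<lambda>n. LINT x : S | lebesgue. w x * T n x) \<longlonglongrightarrow> (LINT x : S | lebesgue. w x * L x)"
    unfolding set_lebesgue_integral_def by (rule tendsto_L1_int[OF g li L1'])
qed

text \<open>Antisymmetry of the kernel makes \<open>K x y (v x - v y)\<close> the symmetrisation of \<open>2 v x K x y\<close>.\<close>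

lemma set_integral_antisymmetric_kernel:
  fixes K :: "'a::euclidean_space \<Rightarrow> 'a \<Rightarrow> real" and v :: "'a \<Rightarrow> real"
  assumes anti: "\<And>x y. K y x = - K x y" and sym: "\<And>x y. (x, y) \<in> S \<Longrightarrow> (y, x) \<in> S"
    and int: "set_integrable lebesgue S (\<lambda>(x, y). v x * K x y)"
  shows "(LINT (x, y) : S | lebesgue. K x y * (v x - v y)) = 2 * (LINT (x, y) : S | lebesgue. v x * K x y)"
proof -
  let ?f = "\<lambda>z. indicator S z *\<^sub>R (case z of (x, y) \<Rightarrow> v x * K x y)"
  have f: "integrable lebesgue ?f"
    using int by (simp add: set_integrable_def)
  have "indicator S z *\<^sub>R (case z of (x, y) \<Rightarrow> K x y * (v x - v y)) = ?f z + (case z of (x, y) \<Rightarrow> ?f (y, x))" for z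
  proof -
    obtain x y where z: "z = (x, y)" by (cases z)
    have "(y, x) \<in> S \<longleftrightarrow> (x, y) \<in> S"
      using sym by blast
    then show ?thesis
      by (simp add: z indicator_def anti[of x y] algebra_simps)
  qed
  then have "(LINT (x, y) : S | lebesgue. K x y * (v x - v y))
      = (LINT z | lebesgue. ?f z + (case z of (x, y) \<Rightarrow> ?f (y, x)))"
    unfolding set_lebesgue_integral_def by presburger
  also have "\<dots> = integral\<^sup>L lebesgue ?f + (LINT (x, y) | lebesgue. ?f (y, x))"
    by (rule Bochner_Integration.integral_add[OF f integrable_lebesgue_swap[OF f]])
  also have "\<dots> = 2 * (LINT (x, y) : S | lebesgue. v x * K x y)"
    unfolding integral_lebesgue_swap[OF f] by (simp add: set_lebesgue_integral_def)
  finally show ?thesis .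
qed

text \<open>Near the diagonal of \<open>\<Omega> \<times> \<Omega>\<close> the term
  \<open>v x * K x y\<close> alone may fail to be integrable although its symmetrisation is. The
  identity is therefore proved on truncated sets first and passed to the limit afterwards.\<close>

lemma
  fixes K :: "'a::euclidean_space \<Rightarrow> 'a \<Rightarrow> real" and v L :: "'a \<Rightarrow> real"
  defines "T \<equiv> \<lambda>\<epsilon> x. LINT y : - ball x \<epsilon> | lebesgue. K x y"
  assumes \<Omega>: "open \<Omega>" and anti: "\<And>x y. K y x = - K x y"
    and energy: "set_integrable lebesgue (cross_domain \<Omega>) (\<lambda>(x, y). K x y * (v x - v y))"
    and int_interior: "\<And>\<epsilon>. 0 < \<epsilon> \<Longrightarrow>
      set_integrable lebesgue {(x, y). x \<in> \<Omega> \<and> y \<notin> ball x \<epsilon>} (\<lambda>(x, y). v x * K x y)"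
    and int_exterior: "set_integrable lebesgue ((- \<Omega>) \<times> \<Omega>) (\<lambda>(x, y). v x * K x y)"
    and ptwise: "AE x in lebesgue. x \<in> \<Omega> \<and> v x \<noteq> 0 \<longrightarrow> ((\<lambda>\<epsilon>. T \<epsilon> x) \<longlongrightarrow> L x) (at_right 0)"
    and L1: "((\<lambda>\<epsilon>. \<integral>\<^sup>+ x \<in> \<Omega>. ennreal (\<bar>v x\<bar> * \<bar>T \<epsilon> x - L x\<bar>) \<partial>lebesgue) \<longlongrightarrow> 0) (at_right 0)"
  shows set_integrable_principal_value: "set_integrable lebesgue \<Omega> (\<lambda>x. v x * L x)"
    and set_integrable_exterior_operator:
      "set_integrable lebesgue (- \<Omega>) (\<lambda>x. v x * (LINT y : \<Omega> | lebesgue. K x y))"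
    and integration_by_parts_antisymmetric_kernel:
      "1 / 2 * (LINT (x, y) : cross_domain \<Omega> | lebesgue. K x y * (v x - v y))
        = (LINT x : \<Omega> | lebesgue. v x * L x)
          + (LINT x : - \<Omega> | lebesgue. v x * (LINT y : \<Omega> | lebesgue. K x y))"
proof -
  let ?\<epsilon> = "\<lambda>n. inverse (real (Suc n))"
  let ?O = "\<lambda>n. {z :: 'a \<times> 'a. ?\<epsilon> n \<le> dist (fst z) (snd z)}"
  let ?A = "\<lambda>n. {(x, y). x \<in> \<Omega> \<and> y \<notin> ball x (?\<epsilon> n)}"
  let ?k = "\<lambda>(x, y). v x * K x y"
  let ?E = "\<lambda>(x, y). K x y * (v x - v y)"
  \<comment> \<open>A sequence of radii replaces the limit over real radii, so that sequential
    convergence theorems apply.\<close>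
  have \<epsilon>: "filterlim ?\<epsilon> (at_right 0) sequentially"
    by (rule tendsto_imp_filterlim_at_right[OF LIMSEQ_inverse_real_of_nat]) simp
  have interior: "set_integrable lebesgue \<Omega> (\<lambda>x. v x * T (?\<epsilon> n) x)"
      "(LINT x : \<Omega> | lebesgue. v x * T (?\<epsilon> n) x) = (LINT z : ?A n | lebesgue. ?k z)" for n
    using set_integrable_weighted_section[of \<Omega> "\<lambda>x. - ball x (?\<epsilon> n)" v K]
      set_integral_weighted_section[of \<Omega> "\<lambda>x. - ball x (?\<epsilon> n)" v K] int_interior[of "?\<epsilon> n"]
    by (simp_all add: T_def)
  have ptwise': "AE x in lebesgue. x \<in> \<Omega> \<and> v x \<noteq> 0 \<longrightarrow> (\<lambda>n. T (?\<epsilon> n) x) \<longlonglongrightarrow> L x"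
    using ptwise
  proof eventually_elim
    case (elim x)
    then show ?case
      using filterlim_compose[OF _ \<epsilon>, of "\<lambda>\<epsilon>. T \<epsilon> x" "nhds (L x)"] by blast
  qed
  have L1': "(\<lambda>n. \<integral>\<^sup>+ x \<in> \<Omega>. ennreal (\<bar>v x\<bar> * \<bar>T (?\<epsilon> n) x - L x\<bar>) \<partial>lebesgue) \<longlonglongrightarrow> 0"
    using filterlim_compose[OF L1 \<epsilon>] .
  show "set_integrable lebesgue \<Omega> (\<lambda>x. v x * L x)"
    by (rule set_integrable_weighted_L1_limit[OF interior(1) ptwise' L1'])
  have lim_interior: "(\<lambda>n. LINT z : ?A n | lebesgue. ?k z) \<longlonglongrightarrow> (LINT x : \<Omega> | lebesgue. v x * L x)"
    using set_integral_weighted_L1_limit[OF interior(1) ptwise' L1'] by (simp only: interior(2))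

  have ext: "{(x, y). x \<in> - \<Omega> \<and> y \<in> \<Omega>} = (- \<Omega>) \<times> \<Omega>" by auto
  show "set_integrable lebesgue (- \<Omega>) (\<lambda>x. v x * (LINT y : \<Omega> | lebesgue. K x y))"
    using set_integrable_weighted_section[of "- \<Omega>" "\<lambda>_. \<Omega>" v K] int_exterior unfolding ext by blast
  have exterior: "(LINT x : - \<Omega> | lebesgue. v x * (LINT y : \<Omega> | lebesgue. K x y))
      = (LINT z : (- \<Omega>) \<times> \<Omega> | lebesgue. ?k z)"
    using set_integral_weighted_section[of "- \<Omega>" "\<lambda>_. \<Omega>" v K] int_exterior unfolding ext by blast
  \<comment> \<open>This set contains no diagonal point, so the vanishing condition is vacuous; for
    the energy below it holds because \<open>v x - v x = 0\<close>.\<close>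
  have lim_exterior: "(\<lambda>n. LINT z : (- \<Omega>) \<times> \<Omega> \<inter> ?O n | lebesgue. ?k z)
      \<longlonglongrightarrow> (LINT z : (- \<Omega>) \<times> \<Omega> | lebesgue. ?k z)"
    by (rule set_integral_off_diagonal_LIMSEQ[OF int_exterior _ LIMSEQ_inverse_real_of_nat]) auto

  have lim_energy: "(\<lambda>n. LINT z : cross_domain \<Omega> \<inter> ?O n | lebesgue. ?E z)
      \<longlonglongrightarrow> (LINT z : cross_domain \<Omega> | lebesgue. ?E z)"
    by (rule set_integral_off_diagonal_LIMSEQ[OF energy _ LIMSEQ_inverse_real_of_nat]) auto
  have sets: "\<Omega> \<times> (UNIV :: 'a set) \<in> sets lebesgue" "(- \<Omega>) \<times> \<Omega> \<in> sets lebesgue"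
  proof -
    show "\<Omega> \<times> (UNIV :: 'a set) \<in> sets lebesgue"
      using \<Omega> by (simp add: open_Times)
    then have "(UNIV :: 'a set) \<times> \<Omega> - \<Omega> \<times> UNIV \<in> sets lebesgue"
      using \<Omega> by (intro sets.Diff) (simp_all add: open_Times)
    moreover have "UNIV \<times> \<Omega> - \<Omega> \<times> UNIV = (- \<Omega>) \<times> \<Omega>" by auto
    ultimately show "(- \<Omega>) \<times> \<Omega> \<in> sets lebesgue" by simp
  qed
  have truncated: "1 / 2 * (LINT z : cross_domain \<Omega> \<inter> ?O n | lebesgue. ?E z)
      = (LINT z : ?A n | lebesgue. ?k z) + (LINT z : (- \<Omega>) \<times> \<Omega> \<inter> ?O n | lebesgue. ?k z)" for n
  proof -
    \<comment> \<open>The ball is open, so pairs at distance exactly \<open>?\<epsilon> n\<close>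
      belong to both descriptions.\<close>
    have A: "?A n = \<Omega> \<times> UNIV \<inter> ?O n" by (auto simp: not_less)
    \<comment> \<open>The split is by the position of \<open>x\<close>: inside
      \<open>\<Omega>\<close> the variable \<open>y\<close> ranges over the whole space, as in the
      truncated operator; outside, \<open>y\<close> must lie in \<open>\<Omega>\<close>, as in the
      normal derivative.\<close>
    have D: "cross_domain \<Omega> \<inter> ?O n = ?A n \<union> (- \<Omega>) \<times> \<Omega> \<inter> ?O n"
      unfolding A by (auto simp: cross_domain_def)
    have A_int: "set_integrable lebesgue (?A n) ?k"
      by (rule int_interior) simp
    have C_int: "set_integrable lebesgue ((- \<Omega>) \<times> \<Omega> \<inter> ?O n) ?k"
      by (rule set_integrable_subset[OF int_exterior]) (use sets sets_lebesgue_off_diagonal in auto)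
    have "?A n \<in> sets lebesgue"
      unfolding A by (intro sets.Int sets sets_lebesgue_off_diagonal)
    then have "set_integrable lebesgue (cross_domain \<Omega> \<inter> ?O n) ?k"
      unfolding D
      by (intro set_integrable_Un A_int C_int sets.Int sets sets_lebesgue_off_diagonal)
    \<comment> \<open>The truncated cross domain is invariant under exchange of the variables, while
      its two pieces need not be; symmetrisation therefore precedes the split.\<close>
    then have "(LINT z : cross_domain \<Omega> \<inter> ?O n | lebesgue. ?E z)
        = 2 * (LINT z : cross_domain \<Omega> \<inter> ?O n | lebesgue. ?k z)"
      by (intro set_integral_antisymmetric_kernel anti) (auto simp: cross_domain_def dist_commute)
    also have "(LINT z : cross_domain \<Omega> \<inter> ?O n | lebesgue. ?k z)
        = (LINT z : ?A n | lebesgue. ?k z) + (LINT z : (- \<Omega>) \<times> \<Omega> \<inter> ?O n | lebesgue. ?k z)"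
      unfolding D by (rule set_integral_Un[OF _ A_int C_int]) auto
    finally show ?thesis by simp
  qed
  have "(\<lambda>n. (LINT z : ?A n | lebesgue. ?k z) + (LINT z : (- \<Omega>) \<times> \<Omega> \<inter> ?O n | lebesgue. ?k z))
      \<longlonglongrightarrow> 1 / 2 * (LINT z : cross_domain \<Omega> | lebesgue. ?E z)"
    unfolding truncated[symmetric] by (intro tendsto_mult_left lim_energy)
  from LIMSEQ_unique[OF this tendsto_add[OF lim_interior lim_exterior]]
  show "1 / 2 * (LINT (x, y) : cross_domain \<Omega> | lebesgue. K x y * (v x - v y))
      = (LINT x : \<Omega> | lebesgue. v x * L x)
        + (LINT x : - \<Omega> | lebesgue. v x * (LINT y : \<Omega> | lebesgue. K x y))"
    unfolding exterior .
qed

section \<open>Application to the nonlocal operators\<close>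

lemma energy_integrand_eq_kernel:
  "energy_integrand s a u v x y = nonlocal_kernel s a u x y * (v x - v y)"
  \<comment> \<open>Off the diagonal the power \<open>s x y\<close> from the quotient of
    \<open>v\<close> joins the dimension in the exponent; on the diagonal both sides vanish since
    \<open>v x - v y = 0\<close>.\<close>
  by (cases "x = y")
     (auto simp: energy_integrand_def nonlocal_kernel_def hoelder_quotient_def powr_add powr_realpow)

lemma nonlocal_kernel_antisymmetric:
  assumes "\<And>x y. s x y = s y x" and "\<And>x y t. a x y t = a y x t"
  shows "nonlocal_kernel s a u y x = - nonlocal_kernel s a u x y"
proof -
  have "hoelder_quotient s u y x = - hoelder_quotient s u x y"
    by (simp add: hoelder_quotient_def assms(1)[of y x] norm_minus_commute minus_divide_left)
  then show ?thesis
    by (simp add: nonlocal_kernel_def assms(1)[of y x] assms(2)[of y x] norm_minus_commute)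
qed

text \<open>Bochner integrals and \<open>Lim\<close> are total and have default values, so the
  identity is asserted together with the integrability of each of its terms.\<close>

theorem proposition3p6:
  fixes \<Omega> :: "'a::euclidean_space set"
    and \<beta> :: "'a \<Rightarrow> real"
    and s :: "nat \<Rightarrow> 'a \<Rightarrow> 'a \<Rightarrow> real"
    and a :: "nat \<Rightarrow> 'a \<Rightarrow> 'a \<Rightarrow> real \<Rightarrow> real"
    and \<phi>m \<phi>p :: "nat \<Rightarrow> real"
    and i :: nat
    and u v :: "'a \<Rightarrow> real"
  assumes "open \<Omega>" and "bounded \<Omega>" and "lipschitz_boundary \<Omega>"
    and "\<beta> \<in> borel_measurable (lebesgue_on (- \<Omega>))"
    and "\<exists>M. AE x in lebesgue_on (- \<Omega>). \<bar>\<beta> x\<bar> \<le> M"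
    and "AE x in lebesgue_on (- \<Omega>). 0 \<le> \<beta> x"
    and "\<And>j. j \<in> {1, 2} \<Longrightarrow> variable_order (s j)"
    and "\<And>j. j \<in> {1, 2} \<Longrightarrow> musielak_structure (a j) (\<phi>m j) (\<phi>p j)"
    and "i \<in> {1, 2}"
    and "u \<in> X_space \<Omega> \<beta> (s i) (a i)" and "v \<in> X_space \<Omega> \<beta> (s i) (a i)"
  shows "set_integrable lebesgue (cross_domain \<Omega>) (\<lambda>(x, y). energy_integrand (s i) (a i) u v x y) \<and>
    (pairings_defined \<Omega> (s i) (a i) u v \<longrightarrow>
       set_integrable lebesgue \<Omega> (\<lambda>x. v x * fractional_laplacian (s i) (a i) u x) \<and>
       set_integrable lebesgue (- \<Omega>) (\<lambda>x. v x * nonlocal_normal_derivative \<Omega> (s i) (a i) u x) \<and>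
       1 / 2 * (LINT (x, y) : cross_domain \<Omega> | lebesgue. energy_integrand (s i) (a i) u v x y)
         = (LINT x : \<Omega> | lebesgue. v x * fractional_laplacian (s i) (a i) u x)
           + (LINT x : - \<Omega> | lebesgue. v x * nonlocal_normal_derivative \<Omega> (s i) (a i) u x))"
proof -
  let ?k = "nonlocal_kernel (s i) (a i) u"
  let ?T = "\<lambda>\<epsilon> x. LINT y : - ball x \<epsilon> | lebesgue. ?k x y"
  let ?L = "fractional_laplacian (s i) (a i) u"
  interpret musielak "a i" "\<phi>m i" "\<phi>p i"
    using assms by unfold_locales auto
  have s: "continuous_on UNIV (\<lambda>(x, y). s i x y)" and s_sym: "s i x y = s i y x" for x y
    using assms(7)[OF assms(9)] by (auto simp: variable_order_def)
  have anti: "?k y x = - ?k x y" for x y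
    using s_sym a_commute by (rule nonlocal_kernel_antisymmetric)
  have "gagliardo_seminorm \<Omega> (s i) (a i) w < \<infinity>" "w \<in> borel_measurable lebesgue"
    if "w \<in> X_space \<Omega> \<beta> (s i) (a i)" for w
    using that by (auto simp: X_space_def X_norm_def less_top)
  then have E: "set_integrable lebesgue (cross_domain \<Omega>) (\<lambda>(x, y). energy_integrand (s i) (a i) u v x y)"
    using assms by (intro set_integrable_energy_integrand[OF _ s]) auto
  then have energy: "set_integrable lebesgue (cross_domain \<Omega>) (\<lambda>(x, y). ?k x y * (v x - v y))"
    by (simp only: energy_integrand_eq_kernel)
  show ?thesis
  proof (intro conjI[OF E] impI)
    assume "pairings_defined \<Omega> (s i) (a i) u v"
    then have interior: "\<forall>\<epsilon>>0.
          set_integrable lebesgue {(x, y). x \<in> \<Omega> \<and> y \<notin> ball x \<epsilon>} (\<lambda>(x, y). v x * ?k x y)"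
      and int_exterior: "set_integrable lebesgue ((- \<Omega>) \<times> \<Omega>) (\<lambda>(x, y). v x * ?k x y)"
      and conv: "AE x in lebesgue. x \<in> \<Omega> \<and> v x \<noteq> 0 \<longrightarrow> (\<exists>l. ((\<lambda>\<epsilon>. ?T \<epsilon> x) \<longlongrightarrow> l) (at_right 0))"
      and L1: "((\<lambda>\<epsilon>. \<integral>\<^sup>+ x \<in> \<Omega>. ennreal (\<bar>v x\<bar> * \<bar>?T \<epsilon> x - ?L x\<bar>) \<partial>lebesgue) \<longlongrightarrow> 0) (at_right 0)"
      unfolding pairings_defined_def truncated_laplacian_def by - (elim conjE, assumption)+
    \<comment> \<open>\<open>Lim\<close> denotes a genuine limit only where one exists; uniqueness
      of limits then turns the mere existence in \<open>conv\<close> into convergence to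
      \<open>?L x\<close>.\<close>
    have ptwise: "AE x in lebesgue. x \<in> \<Omega> \<and> v x \<noteq> 0 \<longrightarrow> ((\<lambda>\<epsilon>. ?T \<epsilon> x) \<longlongrightarrow> ?L x) (at_right 0)"
      using conv
    proof eventually_elim
      case (elim x)
      show ?case
      proof
        assume "x \<in> \<Omega> \<and> v x \<noteq> 0"
        with elim obtain l where "((\<lambda>\<epsilon>. ?T \<epsilon> x) \<longlongrightarrow> l) (at_right 0)" by blast
        moreover from this have "?L x = l"
          unfolding fractional_laplacian_def truncated_laplacian_def
          by (intro tendsto_Lim) auto
        ultimately show "((\<lambda>\<epsilon>. ?T \<epsilon> x) \<longlongrightarrow> ?L x) (at_right 0)" by simp
      qed
    qed
    note hyps = \<open>open \<Omega>\<close> anti energy interior[rule_format] int_exterior ptwise L1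
    show "set_integrable lebesgue \<Omega> (\<lambda>x. v x * ?L x) \<and>
       set_integrable lebesgue (- \<Omega>) (\<lambda>x. v x * nonlocal_normal_derivative \<Omega> (s i) (a i) u x) \<and>
       1 / 2 * (LINT (x, y) : cross_domain \<Omega> | lebesgue. energy_integrand (s i) (a i) u v x y)
         = (LINT x : \<Omega> | lebesgue. v x * ?L x)
           + (LINT x : - \<Omega> | lebesgue. v x * nonlocal_normal_derivative \<Omega> (s i) (a i) u x)"
      unfolding nonlocal_normal_derivative_def energy_integrand_eq_kernel
      by (intro conjI set_integrable_principal_value[OF hyps] set_integrable_exterior_operator[OF hyps]
            integration_by_parts_antisymmetric_kernel[OF hyps])
  qed
qed

end
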